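(* Let $n\ge 2$ be an integer and let $X$ be an $n$-Hausdorff quasiregular homogeneous topological space. Then $|X|\le 2^{c(X)\pi\chi(X)}$.
   Context: No separation axioms are assumed unless stated. The Hausdorff number $H(X)$ of a topological space $X$ is the least cardinal $\kappa$ (finite or infinite) such that for every $A\subseteq X$ with $|A|\ge\kappa$ there are open neighbourhoods $U_a$ of $a$, for $a\in A$, with $\bigcap_{a\in A}U_a=\emptyset$. $X$ is $n$-Hausdorff if $H(X)\le n$. $X$ is quasiregular if every nonempty open set contains a nonempty regular closed set (a set equal to the closure of its interior). $X$ is homogeneous if for all $x,y\in X$ there is a homeomorphism $h:X\to X$ with $h(x)=y$. $c(X)$ is the cellularity (supremum of cardinalities of families of pairwise disjoint nonempty open sets) and $\pi\chi(X)$ is the $\pi$-character (supremum over $x\in X$ of the least cardinality of a local $\pi$-base at $x$, i.e. a family of nonempty open sets such that each neighbourhood of $x$ contains a member of it). All cardinal functions are multiplied by $\omega$, hence are infinite. *)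

theory Defs
  imports "HOL-Analysis.Analysis"
begin

unbundle cardinal_syntax

section \<open>Least cardinals and suprema of cardinals\<close>

text \<open>
  Cardinals are represented by cardinal orders (\<^const>\<open>card_order_on\<close>), up to \<^const>\<open>ordIso\<close>.
  A cardinal order of type \<^typ>\<open>'b rel\<close> has cardinality at most that of \<^typ>\<open>'b\<close>, so the
  type at which a least cardinal is taken has to be large enough for a witness to exist.
\<close>

definition is_least_card :: "('b rel \<Rightarrow> bool) \<Rightarrow> 'b rel \<Rightarrow> bool" where
  "is_least_card P \<kappa> \<longleftrightarrow>
     Card_order \<kappa> \<and> P \<kappa> \<and> (\<forall>\<mu>. Card_order \<mu> \<and> P \<mu> \<longrightarrow> \<kappa> \<le>o \<mu>)"

definition least_card :: "('b rel \<Rightarrow> bool) \<Rightarrow> 'b rel" where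
  "least_card P = (SOME \<kappa>. is_least_card P \<kappa>)"

lemma is_least_card_least_card:
  assumes "Card_order \<mu>" "P \<mu>"
  shows "is_least_card P (least_card P)"
proof -
  let ?R = "{\<kappa>. Card_order \<kappa> \<and> P \<kappa>}"
  have "?R \<noteq> {}" "\<forall>\<kappa>\<in>?R. Card_order \<kappa>"
    using assms by auto
  from exists_minim_Card_order[OF this] obtain \<kappa> where "\<kappa> \<in> ?R" "\<forall>\<mu>\<in>?R. \<kappa> \<le>o \<mu>"
    by blast
  then have "is_least_card P \<kappa>"
    by (auto simp: is_least_card_def)
  then show ?thesis
    unfolding least_card_def by (rule someI)
qed

definition card_sup :: "'b rel set \<Rightarrow> 'b rel" where
  "card_sup K = least_card (\<lambda>\<kappa>. \<forall>\<mu>\<in>K. \<mu> \<le>o \<kappa>)"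

lemma card_sup:
  fixes K :: "'b rel set"
  assumes "\<forall>\<mu>\<in>K. Card_order \<mu>"
  shows "is_least_card (\<lambda>\<kappa>. \<forall>\<mu>\<in>K. \<mu> \<le>o \<kappa>) (card_sup K)"
  unfolding card_sup_def
proof (rule is_least_card_least_card)
  show "Card_order |UNIV :: 'b set|"
    by (rule card_of_Card_order)
  show "\<forall>\<mu>\<in>K. \<mu> \<le>o |UNIV :: 'b set|"
  proof
    fix \<mu> assume "\<mu> \<in> K"
    then have "|Field \<mu>| =o \<mu>"
      using assms by (simp add: card_of_Field_ordIso)
    from ordIso_ordLeq_trans[OF ordIso_symmetric[OF this] card_of_mono1[OF subset_UNIV]]
    show "\<mu> \<le>o |UNIV :: 'b set|" .
  qed
qed


section \<open>Hausdorff number\<close>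

text \<open>
  The intersection is taken inside the space, so that it is the whole space for \<open>A = {}\<close>.
\<close>

definition hausdorff_bound :: "'a topology \<Rightarrow> 'b rel \<Rightarrow> bool" where
  "hausdorff_bound X \<kappa> \<longleftrightarrow>
     (\<forall>A. A \<subseteq> topspace X \<and> \<kappa> \<le>o |A| \<longrightarrow>
        (\<exists>U. (\<forall>a\<in>A. openin X (U a) \<and> a \<in> U a) \<and> topspace X \<inter> (\<Inter>a\<in>A. U a) = {}))"

text \<open>
  The successor cardinal of \<open>|topspace X|\<close> is vacuously a bound, and it lives on \<^typ>\<open>'a set\<close>
  but in general not on \<^typ>\<open>'a\<close>.
\<close>

definition hausdorff_number :: "'a topology \<Rightarrow> 'a set rel" where
  "hausdorff_number X = least_card (hausdorff_bound X)"

lemma hausdorff_number: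
  "is_least_card (hausdorff_bound X) (hausdorff_number X)"
  unfolding hausdorff_number_def
proof (rule is_least_card_least_card)
  let ?s = "cardSuc |topspace X|"
  show "Card_order ?s"
    by (simp add: cardSuc_Card_order card_of_Card_order)
  show "hausdorff_bound X ?s"
    unfolding hausdorff_bound_def
  proof (intro allI impI)
    fix A assume A: "A \<subseteq> topspace X \<and> ?s \<le>o |A|"
    have "?s \<le>o |topspace X|"
      by (rule ordLeq_transitive[OF conjunct2[OF A] card_of_mono1[OF conjunct1[OF A]]])
    then have False
      using not_ordLess_ordLeq[OF cardSuc_greater[OF card_of_Card_order]] by contradiction
    then show "\<exists>U. (\<forall>a\<in>A. openin X (U a) \<and> a \<in> U a) \<and> topspace X \<inter> (\<Inter>a\<in>A. U a) = {}" ..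
  qed
qed

definition n_Hausdorff :: "nat \<Rightarrow> 'a topology \<Rightarrow> bool" where
  "n_Hausdorff n X \<longleftrightarrow> hausdorff_number X \<le>o |{..<n}|"


section \<open>Quasiregular and homogeneous spaces\<close>

definition regular_closedin :: "'a topology \<Rightarrow> 'a set \<Rightarrow> bool" where
  "regular_closedin X C \<longleftrightarrow> C = X closure_of (X interior_of C)"

definition quasiregular_space :: "'a topology \<Rightarrow> bool" where
  "quasiregular_space X \<longleftrightarrow>
     (\<forall>U. openin X U \<and> U \<noteq> {} \<longrightarrow> (\<exists>C. regular_closedin X C \<and> C \<noteq> {} \<and> C \<subseteq> U))"

definition homogeneous_space :: "'a topology \<Rightarrow> bool" where
  "homogeneous_space X \<longleftrightarrow>
     (\<forall>x\<in>topspace X. \<forall>y\<in>topspace X. \<exists>h. homeomorphic_map X X h \<and> h x = y)"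


section \<open>Cellularity and pi-character\<close>

text \<open>
  Both are multiplied by \<open>\<omega>\<close> (\<^const>\<open>natLeq\<close>), hence infinite if the space is nonempty;
  for the empty space the suprema are zero.
\<close>

definition cellular_family :: "'a topology \<Rightarrow> 'a set set \<Rightarrow> bool" where
  "cellular_family X \<U> \<longleftrightarrow> (\<forall>U\<in>\<U>. openin X U \<and> U \<noteq> {}) \<and> pairwise disjnt \<U>"

definition cellularity :: "'a topology \<Rightarrow> (nat \<times> 'a set) rel" where
  "cellularity X = natLeq *c card_sup {card_of \<U> |\<U>. cellular_family X \<U>}"

definition local_pi_base :: "'a topology \<Rightarrow> 'a \<Rightarrow> 'a set set \<Rightarrow> bool" where
  "local_pi_base X x \<B> \<longleftrightarrow>
     (\<forall>B\<in>\<B>. openin X B \<and> B \<noteq> {}) \<and>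
     (\<forall>U. openin X U \<and> x \<in> U \<longrightarrow> (\<exists>B\<in>\<B>. B \<subseteq> U))"

definition local_pi_character :: "'a topology \<Rightarrow> 'a \<Rightarrow> 'a set rel" where
  "local_pi_character X x = least_card (\<lambda>\<kappa>. \<exists>\<B>. local_pi_base X x \<B> \<and> \<kappa> = |\<B>| )"

lemma local_pi_character:
  "is_least_card (\<lambda>\<kappa>. \<exists>\<B>. local_pi_base X x \<B> \<and> \<kappa> = |\<B>| ) (local_pi_character X x)"
  unfolding local_pi_character_def
proof (rule is_least_card_least_card)
  show "Card_order |{B. openin X B \<and> B \<noteq> {}}|"
    by (rule card_of_Card_order)
  have "local_pi_base X x {B. openin X B \<and> B \<noteq> {}}"
    by (auto simp: local_pi_base_def)
  then show "\<exists>\<B>. local_pi_base X x \<B> \<and> |{B. openin X B \<and> B \<noteq> {}}| = |\<B>|"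
    by blast
qed

definition pi_character :: "'a topology \<Rightarrow> (nat \<times> 'a set) rel" where
  "pi_character X = natLeq *c card_sup {local_pi_character X x |x. x \<in> topspace X}"

end

theory Submission
  imports Defs
begin

text \<open>
  Put \<open>\<kappa> = c(X) \<pi>\<chi>(X)\<close>. Closing off a family \<open>\<E>\<close> of at most \<open>2\<^sup>\<kappa>\<close> open sets in \<open>\<kappa>\<^sup>+\<close> steps, one
  picks for every subfamily \<open>\<W>\<close> of size at most \<open>\<kappa>\<close> a point outside the closure of \<open>\<Union>\<W>\<close> and
  adds a local \<open>\<pi>\<close>-base at that point. The picked points are dense: if they miss a nonempty regular
  closed \<open>C\<close>, let \<open>\<W>\<close> be a maximal disjoint subfamily of the members of \<open>\<E>\<close> that miss \<open>C\<close>; the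
  local \<open>\<pi>\<close>-base at the point picked for \<open>\<W>\<close> contradicts the maximality.

  Now fix a point \<open>p\<close>, a local \<open>\<pi>\<close>-base \<open>\<B>\<close> at \<open>p\<close> with \<open>|\<B>| \<le> \<kappa>\<close>, and homeomorphisms \<open>h\<^sub>x\<close> with
  \<open>h\<^sub>x p = x\<close>. Send \<open>x\<close> to a function that chooses for every \<open>B \<in> \<B>\<close> a point of the dense set in
  \<open>h\<^sub>x B\<close>. If \<open>n\<close> points have neighbourhoods \<open>U\<^sub>x\<close> with empty intersection, then some \<open>B\<close> lies in all
  \<open>h\<^sub>x\<^sup>-\<^sup>1 U\<^sub>x\<close>, so these points do not all have the same image; hence fibres have fewer than \<open>n\<close>
  points and \<open>|X| \<le> (2\<^sup>\<kappa>)\<^sup>\<kappa> = 2\<^sup>\<kappa>\<close>.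
\<close>

section \<open>Cardinal arithmetic\<close>

lemma Cinfinite_ctwo_cexp: "Cinfinite k \<Longrightarrow> Cinfinite (ctwo ^c k)"
  by (simp add: Cinfinite_cexp ordLeq_refl Card_order_ctwo)

lemma finite_ordLeq_Cinfinite:
  assumes "finite A" "Cinfinite r"
  shows "|A| \<le>o r"
proof (rule ordLess_imp_ordLeq, rule finite_ordLess_infinite)
  show "Well_order |A|" "Well_order r"
    using assms(2) by (auto intro: card_of_Well_order card_order_on_well_order_on)
  show "finite (Field |A| )" "infinite (Field r)"
    using assms by (simp_all add: Field_card_of cinfinite_def)
qed

lemma Cnotzero_card_of: "A \<noteq> {} \<Longrightarrow> Cnotzero |A|"
  by (simp add: card_of_ordIso_czero_iff_empty card_of_Card_order)

text \<open>Cardinal exponent law: |B|^|A| is at most (2^k)^|A| = 2^(k |A|) = 2^k, the last equality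
  by absorption, as 1 \<le> |A| \<le> k.\<close>

lemma card_of_Func_ordLeq_ctwo_cexp:
  assumes k: "Cinfinite k" and B: "|B| \<le>o ctwo ^c k" and A: "|A| \<le>o k" "A \<noteq> {}"
  shows "|Func A B| \<le>o ctwo ^c k"
proof -
  have "Cnotzero |A|"
    using A(2) by (rule Cnotzero_card_of)
  then have "(ctwo ^c k) ^c |A| =o ctwo ^c k"
    using k A(1) by (intro cexp_cprod_ordLeq Card_order_ctwo)
  with cexp_mono1[OF B card_of_Card_order] have "|B| ^c |A| \<le>o ctwo ^c k"
    by (rule ordLeq_ordIso_trans)
  then show ?thesis
    by (simp add: cexp_def Field_card_of)
qed

text \<open>A nonempty subset of size at most k is the image of a function from
  \<open>Field k\<close> to \<open>E\<close>, and there are at most 2^k of these. The empty set is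
  added by hand, being no such image.\<close>

lemma card_of_small_subsets:
  fixes E :: "'b set"
  assumes k: "Cinfinite k" and E: "|E| \<le>o ctwo ^c k"
  shows "|{W. W \<subseteq> E \<and> |W| \<le>o k}| \<le>o ctwo ^c k"
proof -
  let ?F = "(\<lambda>g. g ` Field k) ` Func (Field k) E"
  have "{W. W \<subseteq> E \<and> |W| \<le>o k} \<subseteq> {{}} \<union> ?F"
  proof clarify
    fix W assume W: "W \<subseteq> E" "|W| \<le>o k" "W \<notin> ?F"
    show "W = {}"
    proof (rule ccontr)
      assume "W \<noteq> {}"
      have "|W| \<le>o |Field k|"
        using W(2) k card_of_Field_ordIso ordIso_symmetric ordLeq_ordIso_trans by blast
      with card_of_ordLeq2[OF \<open>W \<noteq> {}\<close>] obtain g where g: "g ` Field k = W"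
        by metis
      \<comment> \<open>\<open>Func\<close> admits only functions that are \<open>undefined\<close>
        off their domain.\<close>
      define g' where "g' = (\<lambda>a. if a \<in> Field k then g a else undefined)"
      have "g' \<in> Func (Field k) E" "g' ` Field k = W"
        using g W(1) by (auto simp: g'_def Func_def)
      with W(3) show False
        by blast
    qed
  qed
  then have "|{W. W \<subseteq> E \<and> |W| \<le>o k}| \<le>o |{{}} \<union> ?F|"
    by (rule card_of_mono1)
  also have "|{{}} \<union> ?F| \<le>o ctwo ^c k"
  proof (rule Un_Cinfinite_bound)
    have inf: "Cinfinite (ctwo ^c k)"
      using k by (rule Cinfinite_ctwo_cexp)
    then show "|{{} :: 'b set}| \<le>o ctwo ^c k"
      by (intro finite_ordLeq_Cinfinite) simp_all
    have "Field k \<noteq> {}"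
      using k by (auto simp: cinfinite_def)
    then have "|Func (Field k) E| \<le>o ctwo ^c k"
      using k E card_of_Field_ordIso ordIso_imp_ordLeq
      by (intro card_of_Func_ordLeq_ctwo_cexp) auto
    then show "|?F| \<le>o ctwo ^c k"
      using card_of_image ordLeq_transitive by blast
    show "Cinfinite (ctwo ^c k)" by (fact inf)
  qed
  finally show ?thesis .
qed

text \<open>Recursion along the successor cardinal of k, which is regular: a subset of size at most
  k of the union of the stages already lies in one stage, and every later stage contains its value
  under \<open>H\<close>.\<close>

lemma exists_closed_under_small_subsets:
  fixes H :: "'b set \<Rightarrow> 'b set"
  assumes k: "Cinfinite k" and H: "\<And>W. |H W| \<le>o ctwo ^c k"
  obtains E where "|E| \<le>o ctwo ^c k" "\<And>W. W \<subseteq> E \<Longrightarrow> |W| \<le>o k \<Longrightarrow> H W \<subseteq> E"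
proof -
  let ?r = "cardSuc k"
  have r: "Card_order ?r" "Cinfinite ?r"
    using k by (auto simp: cardSuc_Card_order Cinfinite_cardSuc)
  have wo: "wo_rel ?r"
    using r(1) by (simp add: wo_rel_def card_order_on_well_order_on)
  define G where "G Q = (\<Union>W\<in>{W. W \<subseteq> Q \<and> |W| \<le>o k}. H W)" for Q
  \<comment> \<open>Taking the union over all earlier stages treats zero, successor and limit
    indices uniformly.\<close>
  define F where "F f i = (\<Union>j\<in>underS ?r i. f j \<union> G (f j))" for f i
  define As where "As = wo_rel.worec ?r F"
  have "wo_rel.adm_wo ?r F"
    unfolding wo_rel.adm_wo_def[OF wo] F_def by auto
  then have As: "As i = (\<Union>j\<in>underS ?r i. As j \<union> G (As j))" for i
    using wo_rel.worec_fixpoint[OF wo, of F] unfolding As_def[symmetric] by (metis F_def)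
  have inf: "Cinfinite (ctwo ^c k)"
    using k by (rule Cinfinite_ctwo_cexp)
  \<comment> \<open>The recursion has at most 2^k steps: k < 2^k by Cantor, so the successor of k is
    at most 2^k.\<close>
  have r_le: "|Field ?r| \<le>o ctwo ^c k"
    using k r(1) ordLess_ctwo_cexp cardSuc_least card_of_Field_ordIso ordIso_ordLeq_trans Card_order_cexp
    by metis
  have bound: "|As i| \<le>o ctwo ^c k" for i
  proof (induction i rule: wo_rel.well_order_induct[OF wo])
    case (1 i)
    have "|underS ?r i| \<le>o ctwo ^c k"
      by (rule ordLeq_transitive[OF card_of_mono1 r_le]) (auto intro: underS_Field)
    moreover have "|As j \<union> G (As j)| \<le>o ctwo ^c k" if "j \<in> underS ?r i" for j
    proof -
      have "|As j| \<le>o ctwo ^c k"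
        using 1 that by (auto simp: underS_def)
      moreover from this have "|G (As j)| \<le>o ctwo ^c k"
        unfolding G_def using H k inf by (intro UNION_Cinfinite_bound card_of_small_subsets) auto
      ultimately show ?thesis
        using inf by (rule Un_Cinfinite_bound)
    qed
    ultimately show ?case
      using inf by (subst As) (auto intro!: UNION_Cinfinite_bound)
  qed
  have chain: "relChain ?r As"
    unfolding relChain_def
  proof clarify
    fix i j x assume "(i, j) \<in> ?r" "x \<in> As i"
    moreover have "underS ?r i \<subseteq> underS ?r j"
      using underS_incr[OF wo_rel.TRANS[OF wo] wo_rel.ANTISYM[OF wo]] \<open>(i, j) \<in> ?r\<close> by blast
    ultimately show "x \<in> As j"
      by (subst As) (subst (asm) As, blast)
  qed
  show thesis
  proof
    show "|\<Union>i\<in>Field ?r. As i| \<le>o ctwo ^c k"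
      using r_le bound inf by (intro UNION_Cinfinite_bound) auto
    fix W assume W: "W \<subseteq> (\<Union>i\<in>Field ?r. As i)" "|W| \<le>o k"
    then obtain i where i: "i \<in> Field ?r" "W \<subseteq> As i"
      using cardSuc_UNION_Cinfinite[OF k chain] by blast
    \<comment> \<open>An infinite cardinal has no last element, so there is a stage strictly after
      \<open>i\<close>.\<close>
    obtain j where j: "j \<in> Field ?r" "i \<noteq> j" "(i, j) \<in> ?r"
      using infinite_Card_order_limit[OF r(1) _ i(1)] r(2) by (auto simp: cinfinite_def)
    have "H W \<subseteq> As j"
      using i(2) W(2) j by (subst As) (auto simp: G_def underS_def)
    then show "H W \<subseteq> (\<Union>i\<in>Field ?r. As i)"
      using j(1) by blast
  qed
qed

section \<open>Cellularity, \<open>\<pi>\<close>-character and Hausdorff number\<close>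

lemma local_pi_base_nonempty: "local_pi_base X x \<B> \<Longrightarrow> x \<in> topspace X \<Longrightarrow> \<B> \<noteq> {}"
  unfolding local_pi_base_def by blast

lemma card_sup_upper: "\<mu> \<in> K \<Longrightarrow> \<forall>\<mu>\<in>K. Card_order \<mu> \<Longrightarrow> \<mu> \<le>o card_sup K"
  using card_sup[of K] by (auto simp: is_least_card_def)

text \<open>The nonzero member keeps the supremum from being zero, in which case multiplying by
  \<omega> would not make it infinite.\<close>

lemma natLeq_cprod_card_sup:
  assumes "\<mu> \<in> K" "Cnotzero \<mu>" "\<forall>\<mu>\<in>K. Card_order \<mu>"
  shows "Cinfinite (natLeq *c card_sup K)" "\<nu> \<in> K \<Longrightarrow> \<nu> \<le>o natLeq *c card_sup K"
proof -
  have co: "Card_order (card_sup K)"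
    using card_sup[OF assms(3)] by (simp add: is_least_card_def)
  then have "Cnotzero (card_sup K)"
    using Cnotzero_mono[OF assms(2)] card_sup_upper[OF assms(1,3)] by blast
  then have "natLeq \<le>o natLeq *c card_sup K"
    using cprod_com[of "card_sup K" natLeq] ordLeq_cprod2[OF _ natLeq_Card_order]
      ordLeq_ordIso_trans by blast
  then show "Cinfinite (natLeq *c card_sup K)"
    using cinfinite_mono natLeq_cinfinite Card_order_cprod by blast
  show "\<nu> \<le>o natLeq *c card_sup K" if "\<nu> \<in> K"
    using card_sup_upper[OF that assms(3)] ordLeq_cprod2[OF Cinfinite_Cnotzero[OF natLeq_Cinfinite] co]
    by (rule ordLeq_transitive)
qed

lemma cellularity:
  assumes "topspace X \<noteq> {}"
  shows "Cinfinite (cellularity X)" "cellular_family X \<U> \<Longrightarrow> |\<U>| \<le>o cellularity X"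
proof -
  let ?K = "{card_of \<U> |\<U>. cellular_family X \<U>}"
  have "cellular_family X {topspace X}"
    using assms by (simp add: cellular_family_def)
  then have "|{topspace X}| \<in> ?K" "Cnotzero |{topspace X}|" "\<forall>\<mu>\<in>?K. Card_order \<mu>"
    using Cnotzero_card_of[of "{topspace X}"] by (auto simp: card_of_Card_order)
  note * = natLeq_cprod_card_sup[OF this]
  show "Cinfinite (cellularity X)" "cellular_family X \<U> \<Longrightarrow> |\<U>| \<le>o cellularity X"
    using * unfolding cellularity_def by blast+
qed

lemma pi_character:
  assumes "topspace X \<noteq> {}"
  shows "Cinfinite (pi_character X)"
    and "x \<in> topspace X \<Longrightarrow> \<exists>\<B>. local_pi_base X x \<B> \<and> |\<B>| \<le>o pi_character X"
proof -
  let ?K = "{local_pi_character X x |x. x \<in> topspace X}"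
  have local: "\<exists>\<B>. local_pi_base X x \<B> \<and> local_pi_character X x = |\<B>|" for x
    using local_pi_character[of X x] by (simp add: is_least_card_def)
  obtain p where p: "p \<in> topspace X"
    using assms by blast
  then have "Cnotzero (local_pi_character X p)"
    using local[of p] local_pi_base_nonempty Cnotzero_card_of by metis
  moreover have "\<forall>\<mu>\<in>?K. Card_order \<mu>"
  proof clarify
    fix x show "Card_order (local_pi_character X x)"
      using local[of x] card_of_Card_order by metis
  qed
  ultimately have *: "Cinfinite (pi_character X)" "\<nu> \<in> ?K \<Longrightarrow> \<nu> \<le>o pi_character X" for \<nu>
    using natLeq_cprod_card_sup[of "local_pi_character X p" ?K] p unfolding pi_character_def by blast+
  show "Cinfinite (pi_character X)" by (fact *(1))
  show "\<exists>\<B>. local_pi_base X x \<B> \<and> |\<B>| \<le>o pi_character X" if "x \<in> topspace X"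
  proof -
    have "local_pi_character X x \<le>o pi_character X"
      using that by (intro *(2)) blast
    then show ?thesis
      using local[of x] by metis
  qed
qed

lemma n_Hausdorff_separation:
  assumes "n_Hausdorff n X" "A \<subseteq> topspace X" "card A = n" "finite A"
  obtains U where "\<And>a. a \<in> A \<Longrightarrow> openin X (U a)" "\<And>a. a \<in> A \<Longrightarrow> a \<in> U a"
    "topspace X \<inter> (\<Inter>a\<in>A. U a) = {}"
proof -
  have "|{..<n}| =o |A|"
    using assms(3,4) by (metis card_lessThan card_of_ordIso finite_lessThan finite_same_card_bij)
  then have "hausdorff_number X \<le>o |A|"
    using assms(1) unfolding n_Hausdorff_def by (rule ordLeq_ordIso_trans[rotated])
  moreover have "hausdorff_bound X (hausdorff_number X)"
    using hausdorff_number[of X] by (simp add: is_least_card_def)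
  ultimately have "\<exists>U. (\<forall>a\<in>A. openin X (U a) \<and> a \<in> U a) \<and> topspace X \<inter> (\<Inter>a\<in>A. U a) = {}"
    using assms(2) by (simp add: hausdorff_bound_def)
  then show thesis
    using that by metis
qed

section \<open>Density and cardinality\<close>

text \<open>Zorn's lemma applies because any two members of the union of a chain already lie in one
  family of the chain.\<close>

lemma exists_maximal_disjoint_subfamily:
  obtains \<W> where "\<W> \<subseteq> Q" "pairwise disjnt \<W>"
    "\<And>V. V \<in> Q \<Longrightarrow> \<forall>W\<in>\<W>. disjnt V W \<Longrightarrow> V \<in> \<W>"
proof -
  let ?A = "{\<W>. \<W> \<subseteq> Q \<and> pairwise disjnt \<W>}"
  have "\<exists>M\<in>?A. \<forall>Y\<in>?A. M \<subseteq> Y \<longrightarrow> Y = M"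
  proof (rule subset_Zorn')
    fix C assume C: "subset.chain ?A C"
    then have sub: "C \<subseteq> ?A" and chain: "\<And>Y Z. Y \<in> C \<Longrightarrow> Z \<in> C \<Longrightarrow> Y \<subseteq> Z \<or> Z \<subseteq> Y"
      by (auto simp: subset_chain_def)
    have "disjnt V W" if VW: "V \<in> \<Union>C" "W \<in> \<Union>C" "V \<noteq> W" for V W
    proof -
      obtain Y where "Y \<in> C" "V \<in> Y" "W \<in> Y"
        using VW(1,2) chain by blast
      then show ?thesis
        using sub VW(3) unfolding pairwise_def by blast
    qed
    then show "\<Union>C \<in> ?A"
      using sub unfolding pairwise_def by blast
  qed
  then obtain M where M: "M \<in> ?A" "\<forall>Y\<in>?A. M \<subseteq> Y \<longrightarrow> Y = M" ..
  show thesis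
  proof
    show "M \<subseteq> Q" "pairwise disjnt M"
      using M(1) by auto
    fix V assume "V \<in> Q" "\<forall>W\<in>M. disjnt V W"
    then have "insert V M \<in> ?A"
      using M(1) by (auto simp: pairwise_insert disjnt_sym)
    then show "V \<in> M"
      using M(2)[rule_format, of "insert V M"] by blast
  qed
qed

lemma quasiregular_small_dense_set:
  fixes X :: "'a topology"
  assumes qr: "quasiregular_space X" and k: "Cinfinite k"
    and cell: "\<And>\<U>. cellular_family X \<U> \<Longrightarrow> |\<U>| \<le>o k"
    and pi: "\<And>x. x \<in> topspace X \<Longrightarrow> \<exists>\<B>. local_pi_base X x \<B> \<and> |\<B>| \<le>o k"
  obtains D where "D \<subseteq> topspace X" "|D| \<le>o ctwo ^c k"
    "\<And>U. openin X U \<Longrightarrow> U \<noteq> {} \<Longrightarrow> U \<inter> D \<noteq> {}"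
proof -
  from pi obtain \<V> where \<V>: "\<And>x. x \<in> topspace X \<Longrightarrow> local_pi_base X x (\<V> x)"
      "\<And>x. x \<in> topspace X \<Longrightarrow> |\<V> x| \<le>o k"
    by metis
  let ?ext = "\<lambda>\<W>. topspace X - X closure_of \<Union>\<W>"
  define pick where "pick \<W> = (SOME x. x \<in> ?ext \<W>)" for \<W>
  have pick: "pick \<W> \<in> ?ext \<W>" if "?ext \<W> \<noteq> {}" for \<W>
    unfolding pick_def using that by (metis ex_in_conv someI)
  \<comment> \<open>Closing off adds whole local \<pi>-bases, so that they supply new candidates for
    disjoint families; a dense \<Union>\<W> adds nothing.\<close>
  define H where "H \<W> = (if ?ext \<W> = {} then {} else \<V> (pick \<W>))" for \<W>
  have le: "k \<le>o ctwo ^c k"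
    using k by (simp add: ordLess_ctwo_cexp ordLess_imp_ordLeq)
  have "|H \<W>| \<le>o ctwo ^c k" for \<W>
  proof (cases "?ext \<W> = {}")
    case True
    then show ?thesis
      using Card_order_empty[OF Card_order_cexp] by (simp add: H_def)
  next
    case False
    then have "|H \<W>| \<le>o k"
      using pick[of \<W>] \<V>(2) by (simp add: H_def)
    then show ?thesis
      using le by (rule ordLeq_transitive)
  qed
  then obtain E where E: "|E| \<le>o ctwo ^c k" "\<And>\<W>. \<W> \<subseteq> E \<Longrightarrow> |\<W>| \<le>o k \<Longrightarrow> H \<W> \<subseteq> E"
    using exists_closed_under_small_subsets[OF k] by metis
  \<comment> \<open>If \<Union>\<W> is dense, \<open>pick\<close> is an arbitrary value; the
    intersection discards it should it lie outside the space.\<close>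
  define D where "D = pick ` {\<W>. \<W> \<subseteq> E \<and> |\<W>| \<le>o k} \<inter> topspace X"
  show thesis
  proof
    show "D \<subseteq> topspace X"
      by (auto simp: D_def)
    have "|D| \<le>o |pick ` {\<W>. \<W> \<subseteq> E \<and> |\<W>| \<le>o k}|"
      unfolding D_def by (intro card_of_mono1) auto
    then show "|D| \<le>o ctwo ^c k"
      using ordLeq_transitive[OF card_of_image card_of_small_subsets[OF k E(1)]]
      by (rule ordLeq_transitive)
    fix U assume U: "openin X U" "U \<noteq> {}"
    show "U \<inter> D \<noteq> {}"
    proof
      assume UD: "U \<inter> D = {}"
      from qr U obtain C where rc: "regular_closedin X C" and C: "C \<noteq> {}" "C \<subseteq> U"
        unfolding quasiregular_space_def by blast
      define I where "I = X interior_of C"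
      have CI: "C = X closure_of I"
        using rc unfolding regular_closedin_def I_def .
      then have int: "I \<noteq> {}"
        using C(1) by auto
      have "openin X I" "I \<subseteq> C"
        unfolding I_def by (simp_all add: interior_of_subset)
      have "closedin X C"
        unfolding CI by (rule closedin_closure_of)
      define Q where "Q = {V \<in> E. openin X V \<and> V \<noteq> {} \<and> disjnt V C}"
      obtain \<W> where "\<W> \<subseteq> Q" and disj_\<W>: "pairwise disjnt \<W>"
        and max: "\<And>V. V \<in> Q \<Longrightarrow> \<forall>W\<in>\<W>. disjnt V W \<Longrightarrow> V \<in> \<W>"
        using exists_maximal_disjoint_subfamily[of Q] by metis
      then have \<W>: "W \<in> E" "openin X W" "W \<noteq> {}" "disjnt W C" if "W \<in> \<W>" for W
        using that by (auto simp: Q_def)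
      \<comment> \<open>Cellularity bounds the disjoint family \<W>, so the closure property of
        \<open>E\<close> applies to it.\<close>
      have small: "\<W> \<subseteq> E" "|\<W>| \<le>o k"
        using \<W> disj_\<W> by (auto intro!: cell simp: cellular_family_def)
      have "\<forall>W\<in>\<W>. disjnt W C"
        using \<W>(4) by blast
      \<comment> \<open>The nonempty open set \<open>I\<close> misses \<Union>\<W> and hence its
        closure, so a point could be picked for \<W>.\<close>
      then have "I \<inter> \<Union>\<W> = {}"
        using \<open>I \<subseteq> C\<close> unfolding disjnt_def by blast
      then have "I \<inter> X closure_of \<Union>\<W> = {}"
        using openin_Int_closure_of_eq_empty[OF \<open>openin X I\<close>] by blast
      then have ext: "?ext \<W> \<noteq> {}"
        using int openin_subset[OF \<open>openin X I\<close>] by blast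
      let ?x = "pick \<W>"
      have x: "?x \<in> ?ext \<W>"
        using pick ext by blast
      then have "?x \<in> D"
        using small by (auto simp: D_def)
      then have "?x \<notin> C"
        using UD C(2) by blast
      with x have "?x \<in> ?ext \<W> - C"
        by blast
      moreover have "openin X (?ext \<W> - C)"
        using \<open>closedin X C\<close> by (intro openin_diff) auto
      ultimately obtain V where V: "V \<in> \<V> ?x" "V \<subseteq> ?ext \<W> - C" "openin X V" "V \<noteq> {}"
        using \<V>(1)[of ?x] x unfolding local_pi_base_def by blast
      have "V \<in> E"
        using E(2)[OF small] V(1) ext by (auto simp: H_def)
      have "\<forall>W\<in>\<W>. W \<subseteq> topspace X"
        using \<W>(2) openin_subset by blast
      then have "\<Union>\<W> \<subseteq> X closure_of \<Union>\<W>"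
        by (intro closure_of_subset) blast
      then have disj: "\<forall>W\<in>\<W>. disjnt V W"
        using V(2) unfolding disjnt_def by blast
      then have "V \<in> \<W>"
        using \<open>V \<in> E\<close> V by (intro max) (auto simp: Q_def disjnt_def)
      \<comment> \<open>Being a member of \<W>, \<open>V\<close> is disjoint from itself, though
        nonempty.\<close>
      with disj V(4) show False
        by (auto simp: disjnt_def)
    qed
  qed
qed

lemma homogeneous_n_Hausdorff_card_bound:
  fixes X :: "'a topology"
  assumes n: "n > 0" and nH: "n_Hausdorff n X" and hom: "homogeneous_space X"
    and k: "Cinfinite k" and p: "p \<in> topspace X"
    and \<B>: "local_pi_base X p \<B>" "|\<B>| \<le>o k"
    and D: "D \<subseteq> topspace X" "|D| \<le>o ctwo ^c k" "\<And>U. openin X U \<Longrightarrow> U \<noteq> {} \<Longrightarrow> U \<inter> D \<noteq> {}"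
  shows "|topspace X| \<le>o ctwo ^c k"
proof -
  obtain h where h: "\<And>x. x \<in> topspace X \<Longrightarrow> homeomorphic_map X X (h x)"
      "\<And>x. x \<in> topspace X \<Longrightarrow> h x p = x"
    using hom p unfolding homogeneous_space_def by metis
  define f where "f x = (\<lambda>B. if B \<in> \<B> then SOME d. d \<in> h x ` B \<inter> D else undefined)" for x
  have f: "f x B \<in> h x ` B \<inter> D" if "x \<in> topspace X" "B \<in> \<B>" for x B
  proof -
    \<comment> \<open>Homeomorphisms are open maps, so the dense set meets the image of
      \<open>B\<close>.\<close>
    have "openin X (h x ` B)" "h x ` B \<noteq> {}"
      using homeomorphic_imp_open_map[OF h(1)[OF that(1)]] that(2) \<B>(1)
      by (auto simp: open_map_def local_pi_base_def)
    from D(3)[OF this] show ?thesis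
      unfolding f_def using that(2) by (metis ex_in_conv someI)
  qed
  have "f ` topspace X \<subseteq> Func \<B> D"
    using f by (auto simp: Func_def) (auto simp: f_def)
  then have Fun: "|f ` topspace X| \<le>o ctwo ^c k"
    using card_of_Func_ordLeq_ctwo_cexp[OF k D(2) \<B>(2) local_pi_base_nonempty[OF \<B>(1) p]]
      card_of_mono1 ordLeq_transitive by blast
  \<comment> \<open>Finite fibres suffice for the count, since 2^k is infinite; an infinite fibre
    would contain \<open>n\<close> points to separate.\<close>
  have fibre: "finite {x \<in> topspace X. f x = g}" for g
  proof (rule ccontr)
    assume "infinite {x \<in> topspace X. f x = g}"
    then obtain A where A: "finite A" "card A = n" "A \<subseteq> {x \<in> topspace X. f x = g}"
      using infinite_arbitrarily_large by blast
    then have "A \<subseteq> topspace X" "A \<noteq> {}"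
      using n by auto
    obtain U where U: "\<And>a. a \<in> A \<Longrightarrow> openin X (U a)" "\<And>a. a \<in> A \<Longrightarrow> a \<in> U a"
        "topspace X \<inter> (\<Inter>a\<in>A. U a) = {}"
      using n_Hausdorff_separation[OF nH \<open>A \<subseteq> topspace X\<close> A(2,1)] by blast
    \<comment> \<open>Pulling every \<open>U a\<close> back along \<open>h a\<close> gives
      neighbourhoods of the single point \<open>p\<close>, so one \<pi>-base member serves all
      \<open>a\<close> at once.\<close>
    let ?O = "\<Inter>a\<in>A. {z \<in> topspace X. h a z \<in> U a}"
    have "openin X ?O"
      using A U(1) \<open>A \<noteq> {}\<close> h(1)
      by (intro openin_INT2 openin_continuous_map_preimage homeomorphic_imp_continuous_map) auto
    moreover have "p \<in> ?O"
      using p h(2) U(2) \<open>A \<subseteq> topspace X\<close> by auto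
    ultimately have "\<exists>B\<in>\<B>. B \<subseteq> ?O"
      using \<B>(1) unfolding local_pi_base_def by (elim conjE allE[of _ ?O]) blast
    then obtain B where B: "B \<in> \<B>" "B \<subseteq> ?O" ..
    have "g B \<in> U a" "g B \<in> D" if "a \<in> A" for a
    proof -
      have a: "a \<in> topspace X" "f a = g"
        using A(3) that by auto
      then have "g B \<in> h a ` B" "g B \<in> D"
        using f[OF a(1) B(1)] by auto
      moreover have "h a ` B \<subseteq> U a"
        using B(2) that by auto
      ultimately show "g B \<in> U a" "g B \<in> D"
        by auto
    qed
    then show False
      using U(3) D(1) \<open>A \<noteq> {}\<close> by blast
  qed
  have inf: "Cinfinite (ctwo ^c k)"
    using k by (rule Cinfinite_ctwo_cexp)
  have "|{x \<in> topspace X. f x = g}| \<le>o ctwo ^c k" for g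
    using fibre inf by (rule finite_ordLeq_Cinfinite)
  then have "|\<Union>g\<in>f ` topspace X. {x \<in> topspace X. f x = g}| \<le>o ctwo ^c k"
    using Fun inf by (intro UNION_Cinfinite_bound) auto
  moreover have "topspace X = (\<Union>g\<in>f ` topspace X. {x \<in> topspace X. f x = g})"
    by auto
  ultimately show ?thesis
    by simp
qed

theorem theorem3p8:
  fixes X :: "'a topology" and n :: nat
  assumes "n \<ge> 2"
    and "n_Hausdorff n X"
    and "quasiregular_space X"
    and "homogeneous_space X"
  shows "|topspace X| \<le>o ctwo ^c (cellularity X *c pi_character X)"
\<comment> \<open>Over the empty space both cardinal functions are zero, so the infinite exponent k
  exists only in the other case.\<close>
proof (cases "topspace X = {}")
  case True
  then show ?thesis
    using Card_order_empty[OF Card_order_cexp] by simp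
next
  case False
  let ?k = "cellularity X *c pi_character X"
  have inf: "Cinfinite (cellularity X)" "Cinfinite (pi_character X)"
    using False by (rule cellularity pi_character)+
  then have k: "Cinfinite ?k"
    by (intro Cinfinite_cprod2 Cinfinite_Cnotzero)
  have "cellularity X \<le>o pi_character X *c cellularity X"
    using inf by (intro ordLeq_cprod2 Cinfinite_Cnotzero) auto
  then have "cellularity X \<le>o ?k"
    using cprod_com by (rule ordLeq_ordIso_trans)
  then have cell: "|\<U>| \<le>o ?k" if "cellular_family X \<U>" for \<U>
    using cellularity(2)[OF False that] ordLeq_transitive by blast
  have "pi_character X \<le>o ?k"
    using inf by (intro ordLeq_cprod2 Cinfinite_Cnotzero) auto
  then have pi: "\<exists>\<B>. local_pi_base X x \<B> \<and> |\<B>| \<le>o ?k" if "x \<in> topspace X" for x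
    using pi_character(2)[OF False that] ordLeq_transitive by blast
  obtain D where D: "D \<subseteq> topspace X" "|D| \<le>o ctwo ^c ?k"
      "\<And>U. openin X U \<Longrightarrow> U \<noteq> {} \<Longrightarrow> U \<inter> D \<noteq> {}"
    using quasiregular_small_dense_set[OF assms(3) k cell pi] by blast
  obtain p \<B> where p: "p \<in> topspace X" "local_pi_base X p \<B>" "|\<B>| \<le>o ?k"
    using False pi by blast
  show ?thesis
    using homogeneous_n_Hausdorff_card_bound[OF _ assms(2,4) k p D] assms(1) by simp
qed

end
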